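(* Consider the random walk on the positive integers defined as follows: from state $1$ it moves to state $2$ with probability $1$; from state $2$ it moves to state $1$ with probability $1/2$ and to state $3$ with probability $1/2$; from a state $k\ge 3$ it moves to $k-1$ with probability $3/4$ and to $k+1$ with probability $1/4$. Start the walk at state $1$ and let $N_{1,1}(t)$ be the number of times the walk returns to state $1$ during its first $t$ steps. Then with probability tending to $1$ as $t\to\infty$, $N_{1,1}(t)\ge t/19$. *)

theory Defs
  imports "HOL-Probability.Probability"
begin

locale markov_chain_from = prob_space M
  for M :: "'a measure"
    and K :: "'s::countable \<Rightarrow> 's pmf"
    and x0 :: 's
    and X :: "nat \<Rightarrow> 'a \<Rightarrow> 's" +
  assumes measurable_state: "\<And>n. random_variable (count_space UNIV) (X n)"
    and start: "AE \<omega> in M. X 0 \<omega> = x0"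
    and markov: "\<And>n x. prob {\<omega> \<in> space M. \<forall>i\<le>n. X i \<omega> = x i} > 0 \<Longrightarrow>
      \<P>(\<omega> in M. X (Suc n) \<omega> = x (Suc n) \<bar> (\<forall>i\<le>n. X i \<omega> = x i)) = pmf (K (x n)) (x (Suc n))"

text \<open>The state space is the positive integers; the value at 0 is irrelevant, as 0 is
  unreachable from every positive state.\<close>

definition walk_step :: "nat \<Rightarrow> nat pmf" where
  "walk_step k =
    (if k = 1 then return_pmf 2
     else if k = 2 then map_pmf (\<lambda>down. if down then 1 else 3) (bernoulli_pmf (1/2))
     else map_pmf (\<lambda>down. if down then k - 1 else k + 1) (bernoulli_pmf (3/4)))"

text \<open>The initial time 0 does not count as a return.\<close>

definition num_returns :: "(nat \<Rightarrow> 'a \<Rightarrow> 's) \<Rightarrow> 's \<Rightarrow> nat \<Rightarrow> 'a \<Rightarrow> nat" where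
  "num_returns X s t \<omega> = card {n \<in> {1..t}. X n \<omega> = s}"

end

theory Submission imports Defs "HOL-Real_Asymp.Real_Asymp" begin

text \<open>
  Put \<open>U 0 = 4\<close>, \<open>U 1 = 5\<close> and \<open>U k = 2 k\<close> for \<open>k \<ge> 2\<close>. This solves a Poisson equation for the walk:
  if \<open>C\<^sub>t\<close> counts the visits to 1 at times \<open>0, \<dots>, t\<close>, then \<open>U (X\<^sub>t) + (t + 1) - 5 C\<^sub>t\<close> is a martingale.
  Its increments have second moment at most 9, so its second moment is at most \<open>1 + 9 t\<close>.
  The value at the unreachable state 0 is chosen so that the equation holds there too, which avoids
  tracking positivity of the states.
  As \<open>U \<ge> 0\<close>, fewer than \<open>t / 19\<close> returns force it to be at least \<open>t / 2\<close>,
  which by Markov's inequality for its square has probability \<open>O(1 / t)\<close>.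
\<close>

text \<open>Latest state first: \<open>hd\<close> is the current state and one step of the chain is
  a Cons. The whole path is kept because the visit count depends on it.\<close>

primrec history :: "(nat \<Rightarrow> 'a \<Rightarrow> 's) \<Rightarrow> nat \<Rightarrow> 'a \<Rightarrow> 's list" where
  "history X 0 \<omega> = [X 0 \<omega>]"
| "history X (Suc n) \<omega> = X (Suc n) \<omega> # history X n \<omega>"

primrec history_pmf :: "('s \<Rightarrow> 's pmf) \<Rightarrow> 's \<Rightarrow> nat \<Rightarrow> 's list pmf" where
  "history_pmf K x0 0 = return_pmf [x0]"
| "history_pmf K x0 (Suc n) =
     bind_pmf (history_pmf K x0 n) (\<lambda>l. map_pmf (\<lambda>y. y # l) (K (hd l)))"

lemma length_history [simp]: "length (history X n \<omega>) = Suc n"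
  by (induction n) auto

lemma history_eq_iff:
  "history X n \<omega> = l \<longleftrightarrow> length l = Suc n \<and> (\<forall>i\<le>n. X i \<omega> = l ! (n - i))"
proof (induction n arbitrary: l)
  case 0
  then show ?case by (cases l) auto
next
  case (Suc n)
  show ?case
  proof (cases l)
    case (Cons y k)
    have "(\<forall>i\<le>Suc n. X i \<omega> = l ! (Suc n - i)) \<longleftrightarrow> X (Suc n) \<omega> = y \<and> (\<forall>i\<le>n. X i \<omega> = k ! (n - i))"
      using Cons by (auto simp: le_Suc_eq Suc_diff_le)
    then show ?thesis using Suc[of k] Cons by auto
  qed simp
qed

text \<open>The list includes time 0, which \<open>num_returns\<close> leaves out; hence the
  correction term.\<close>

lemma count_list_history:
  "count_list (history X n \<omega>) s = num_returns X s n \<omega> + (if X 0 \<omega> = s then 1 else 0)"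
proof (induction n)
  case 0
  then show ?case by (simp add: num_returns_def)
next
  case (Suc n)
  have "{m \<in> {1..Suc n}. X m \<omega> = s} =
      (if X (Suc n) \<omega> = s then insert (Suc n) {m \<in> {1..n}. X m \<omega> = s} else {m \<in> {1..n}. X m \<omega> = s})"
    by (auto simp: le_Suc_eq)
  then have "num_returns X s (Suc n) \<omega> = num_returns X s n \<omega> + (if X (Suc n) \<omega> = s then 1 else 0)"
    by (simp add: num_returns_def)
  then show ?case using Suc by auto
qed

text \<open>The tail of \<open>y # l\<close> determines \<open>l\<close>, so only one term of the
  mixture survives.\<close>

lemma pmf_bind_Cons:
  "pmf (bind_pmf p (\<lambda>l. map_pmf (\<lambda>y. y # l) (q l))) (y # l) = pmf p l * pmf (q l) y"
proof -
  have inner: "pmf (map_pmf (\<lambda>y. y # k) (q k)) (y # l) = indicator {l} k * pmf (q l) y" for k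
  proof (cases "k = l")
    case True
    then show ?thesis using pmf_map_inj'[of "\<lambda>y. y # l" "q l" y] by (simp add: inj_def)
  next
    case False
    then show ?thesis by (auto simp: pmf_eq_0_set_pmf)
  qed
  show ?thesis by (simp add: pmf_bind inner measure_pmf_single)
qed

context markov_chain_from
begin

lemma measurable_history: "history X n \<in> measurable M (count_space UNIV)"
proof (induction n)
  case 0
  show ?case
    by (simp add: history.simps[abs_def])
      (rule measurable_compose[OF measurable_state], simp)
next
  case (Suc n)
  \<comment> \<open>Splits over the countably many values \<open>y\<close> of the new state.\<close>
  have "(\<lambda>\<omega>. (\<lambda>y \<omega>. y # history X n \<omega>) (X (Suc n) \<omega>) \<omega>) \<in> measurable M (count_space UNIV)"
    by (rule measurable_compose_countable[OF _ measurable_state])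
      (rule measurable_compose[OF Suc], simp)
  then show ?case by simp
qed

text \<open>Chain rule: \<open>markov\<close> supplies the factor for the last step if the past has
  positive probability; otherwise both sides vanish.\<close>

lemma prob_history: "prob {\<omega> \<in> space M. history X n \<omega> = l} = pmf (history_pmf K x0 n) l"
proof (induction n arbitrary: l)
  case 0
  have [measurable]: "X 0 \<in> measurable M (count_space UNIV)" by (rule measurable_state)
  have "prob {\<omega> \<in> space M. [X 0 \<omega>] = l} = prob {\<omega> \<in> space M. [x0] = l}"
    using start by (intro measure_eq_AE) (auto elim!: AE_mp)
  then show ?case by (auto simp: prob_space indicator_def)
next
  case (Suc n)
  show ?case
  proof (cases l)
    case Nil
    have "[] \<notin> set_pmf (history_pmf K x0 (Suc n))" by auto
    then show ?thesis using Nil by (simp add: pmf_eq_0_set_pmf)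
  next
    case (Cons y k)
    let ?A = "{\<omega> \<in> space M. history X n \<omega> = k}"
    let ?B = "{\<omega> \<in> space M. X (Suc n) \<omega> = y \<and> history X n \<omega> = k}"
    have [measurable]: "?A \<in> sets M"
      using measurable_history[of n] by measurable
    have "prob ?B = pmf (history_pmf K x0 n) k * pmf (K (hd k)) y"
    proof (cases "prob ?A = 0")
      case True
      have "prob ?B \<le> prob ?A" by (rule finite_measure_mono) auto
      then show ?thesis using True Suc[of k] by (simp add: measure_le_0_iff)
    next
      case False
      \<comment> \<open>The reversed list \<open>k\<close> read forward in time and continued by
        \<open>y\<close>, in the form that \<open>markov\<close> expects.\<close>
      define x where "x i = (if i = Suc n then y else k ! (n - i))" for i
      \<comment> \<open>An event of nonzero probability is nonempty, so \<open>k\<close> is an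
        actual history.\<close>
      have len: "length k = Suc n"
        using False by (metis (mono_tags, lifting) Collect_empty_eq length_history measure_empty)
      have hist: "history X n \<omega> = k \<longleftrightarrow> (\<forall>i\<le>n. X i \<omega> = x i)" for \<omega>
        by (auto simp: history_eq_iff len x_def)
      have x: "x (Suc n) = y" "x n = hd k"
        using len by (cases k; simp add: x_def)+
      have "prob {\<omega> \<in> space M. \<forall>i\<le>n. X i \<omega> = x i} > 0"
        using False unfolding hist by (simp add: zero_less_measure_iff)
      from markov[OF this] show ?thesis
        using False Suc[of k] unfolding cond_prob_def x hist[symmetric]
        by (simp add: field_simps)
    qed
    then show ?thesis using Cons by (simp add: pmf_bind_Cons)
  qed
qed

text \<open>Lists over a countable type are countable, so agreement on singletons suffices. Path
  probabilities can now be computed in \<open>history_pmf\<close>.\<close>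

lemma distr_history: "distr M (count_space UNIV) (history X n) = measure_pmf (history_pmf K x0 n)"
proof (rule measure_eqI_countable)
  fix l
  have "emeasure (distr M (count_space UNIV) (history X n)) {l} = ennreal (prob {\<omega> \<in> space M. history X n \<omega> = l})"
    by (subst emeasure_distr[OF measurable_history])
      (auto simp: emeasure_eq_measure vimage_def Int_def conj_commute)
  then show "emeasure (distr M (count_space UNIV) (history X n)) {l} = emeasure (history_pmf K x0 n) {l}"
    by (simp add: prob_history emeasure_pmf_single)
qed (auto simp: measure_pmf.emeasure_space_1)

lemma prob_history_pred:
  "prob {\<omega> \<in> space M. P (history X n \<omega>)} = measure_pmf.prob (history_pmf K x0 n) {l. P l}"
  by (subst distr_history[symmetric], subst measure_distr[OF measurable_history])
    (auto simp: vimage_def Int_def conj_commute)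

end

text \<open>The expected time from \<open>k\<close> to the next visit to 1 at a strictly later time;
  the value 5 at 1 is the mean return time. From 0 the walk stays put with probability 3/4, as
  \<open>0 - 1 = 0\<close> in \<open>nat\<close>.\<close>

definition potential :: "nat \<Rightarrow> real" where
  "potential k = (if k = 0 then 4 else if k = 1 then 5 else 2 * real k)"

definition walk_martingale :: "nat list \<Rightarrow> real" where
  "walk_martingale l = potential (hd l) + real (length l) - 5 * real (count_list l 1)"

lemma potential_nonneg: "potential k \<ge> 0"
  by (simp add: potential_def)

lemma finite_set_walk_step: "finite (set_pmf (walk_step k))"
  by (auto simp: walk_step_def)

text \<open>The increment has mean zero, so the cross term vanishes. Its second moment is 0 at state
  1, 9 at state 2 (increments 3 and -3), and 3 elsewhere.\<close>

lemma second_moment_walk_step: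
  "measure_pmf.expectation (walk_step (hd l)) (\<lambda>y. (walk_martingale (y # l))\<^sup>2)
     \<le> (walk_martingale l)\<^sup>2 + 9"
proof -
  define d where "d = real (length l) - 5 * real (count_list l 1)"
  have m: "walk_martingale (y # l) = d + (potential y + 1 - (if y = 1 then 5 else 0))" for y
    by (simp add: walk_martingale_def d_def)
  have m': "walk_martingale l = potential (hd l) + d"
    by (simp add: walk_martingale_def d_def)
  consider "hd l = 0" | "hd l = 1" | "hd l = 2" | "hd l \<ge> 3" by linarith
  then show ?thesis
    by cases (auto simp: m m' walk_step_def potential_def power2_eq_square field_simps of_nat_diff)
qed

lemma second_moment_walk_martingale:
  "(\<integral>\<^sup>+ l. ennreal ((walk_martingale l)\<^sup>2) \<partial>history_pmf walk_step 1 n) \<le> ennreal (1 + 9 * real n)"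
proof (induction n)
  case 0
  \<comment> \<open>The initial list \<open>[1]\<close> has value 5 + 1 - 5 = 1.\<close>
  then show ?case by (simp add: walk_martingale_def potential_def)
next
  case (Suc n)
  have "(\<integral>\<^sup>+ l. ennreal ((walk_martingale l)\<^sup>2) \<partial>history_pmf walk_step 1 (Suc n)) =
      (\<integral>\<^sup>+ l. (\<integral>\<^sup>+ y. ennreal ((walk_martingale (y # l))\<^sup>2) \<partial>walk_step (hd l)) \<partial>history_pmf walk_step 1 n)"
    by simp
  also have "\<dots> \<le> (\<integral>\<^sup>+ l. ennreal ((walk_martingale l)\<^sup>2) + 9 \<partial>history_pmf walk_step 1 n)"
  proof (rule nn_integral_mono)
    fix l
    have "(\<integral>\<^sup>+ y. ennreal ((walk_martingale (y # l))\<^sup>2) \<partial>walk_step (hd l)) =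
        ennreal (measure_pmf.expectation (walk_step (hd l)) (\<lambda>y. (walk_martingale (y # l))\<^sup>2))"
      \<comment> \<open>Finite support of a single step gives integrability.\<close>
      by (intro nn_integral_eq_integral integrable_measure_pmf_finite finite_set_walk_step) auto
    also have "\<dots> \<le> ennreal ((walk_martingale l)\<^sup>2 + 9)"
      by (intro ennreal_leI second_moment_walk_step)
    finally show "(\<integral>\<^sup>+ y. ennreal ((walk_martingale (y # l))\<^sup>2) \<partial>walk_step (hd l))
        \<le> ennreal ((walk_martingale l)\<^sup>2) + 9" by simp
  qed
  also have "\<dots> = (\<integral>\<^sup>+ l. ennreal ((walk_martingale l)\<^sup>2) \<partial>history_pmf walk_step 1 n) + 9"
    by (simp add: nn_integral_add measure_pmf.emeasure_space_1)
  also have "\<dots> \<le> ennreal (1 + 9 * real n) + ennreal 9"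
    using Suc by (simp add: add_right_mono)
  also have "\<dots> = ennreal (1 + 9 * real (Suc n))"
    by (subst ennreal_plus[symmetric]) auto
  finally show ?case .
qed

lemma prob_walk_martingale_ge:
  assumes "c > 0"
  shows "measure_pmf.prob (history_pmf walk_step 1 n) {l. walk_martingale l \<ge> c} \<le> (1 + 9 * real n) / c\<^sup>2"
proof -
  let ?p = "history_pmf walk_step 1 n"
  have "emeasure ?p {l. walk_martingale l \<ge> c} = (\<integral>\<^sup>+ l. indicator {l. walk_martingale l \<ge> c} l \<partial>?p)"
    by simp
  also have "\<dots> \<le> (\<integral>\<^sup>+ l. ennreal (1 / c\<^sup>2) * ennreal ((walk_martingale l)\<^sup>2) \<partial>?p)"
  proof (rule nn_integral_mono)
    fix l
    \<comment> \<open>Pointwise form of Markov's inequality; \<open>c > 0\<close> allows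
      squaring.\<close>
    have "1 \<le> (walk_martingale l)\<^sup>2 / c\<^sup>2" if "walk_martingale l \<ge> c"
      using assms power_mono[OF that, of 2] by simp
    then show "indicator {l. walk_martingale l \<ge> c} l \<le> ennreal (1 / c\<^sup>2) * ennreal ((walk_martingale l)\<^sup>2)"
      by (auto simp: indicator_def simp flip: ennreal_mult)
  qed
  also have "\<dots> = ennreal (1 / c\<^sup>2) * (\<integral>\<^sup>+ l. ennreal ((walk_martingale l)\<^sup>2) \<partial>?p)"
    by (simp add: nn_integral_cmult)
  also have "\<dots> \<le> ennreal (1 / c\<^sup>2) * ennreal (1 + 9 * real n)"
    by (intro mult_left_mono second_moment_walk_martingale) simp
  also have "\<dots> = ennreal ((1 + 9 * real n) / c\<^sup>2)"
    by (subst ennreal_mult[symmetric]) auto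
  finally show ?thesis
    by (simp add: measure_pmf.emeasure_eq_measure)
qed

theorem theorem2:
  fixes M :: "'a measure" and X :: "nat \<Rightarrow> 'a \<Rightarrow> nat"
  assumes "markov_chain_from M walk_step 1 X"
  shows "(\<lambda>t::nat. \<P>(\<omega> in M. real (num_returns X 1 t \<omega>) \<ge> real t / 19)) \<longlonglongrightarrow> 1"
proof -
  interpret markov_chain_from M walk_step 1 X by fact
  let ?f = "\<lambda>t. \<P>(\<omega> in M. real (num_returns X 1 t \<omega>) \<ge> real t / 19)"
  \<comment> \<open>If \<open>X 0 \<omega> = 1\<close>, a martingale value below t/2 gives 5 N > t/2
    - 4 for the number N of returns. This forces N \<ge> t/19 once 9 t \<ge> 152, that is, from t =
    17 on. If \<open>X 0 \<omega>\<close> is not 1, the bound 5 N > t/2 + 1 is stronger.\<close>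
  have lower: "1 - (1 + 9 * real t) / (real t / 2)\<^sup>2 \<le> ?f t" if t: "t \<ge> 17" for t
  proof -
    let ?p = "history_pmf walk_step 1 t"
    let ?G = "{\<omega> \<in> space M. \<not> walk_martingale (history X t \<omega>) \<ge> real t / 2}"
    let ?R = "{\<omega> \<in> space M. real (num_returns X 1 t \<omega>) \<ge> real t / 19}"
    have "1 - (1 + 9 * real t) / (real t / 2)\<^sup>2 \<le> 1 - measure_pmf.prob ?p {l. walk_martingale l \<ge> real t / 2}"
      using prob_walk_martingale_ge[of "real t / 2" t] t by simp
    also have "\<dots> = measure_pmf.prob ?p {l. \<not> walk_martingale l \<ge> real t / 2}"
      by (subst measure_pmf.prob_compl[symmetric]) (auto intro!: arg_cong2[where f = measure])
    also have "\<dots> = prob ?G"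
      by (rule prob_history_pred[symmetric])
    also have "\<dots> \<le> prob ?R"
    proof (rule finite_measure_mono)
      show "?G \<subseteq> ?R"
      proof safe
        fix \<omega> assume "\<not> walk_martingale (history X t \<omega>) \<ge> real t / 2"
        then show "real (num_returns X 1 t \<omega>) \<ge> real t / 19"
          using t potential_nonneg[of "hd (history X t \<omega>)"]
          by (auto simp: walk_martingale_def count_list_history split: if_splits)
      qed
      have [measurable]: "X n \<in> measurable M (count_space UNIV)" for n by (rule measurable_state)
      \<comment> \<open>As a finite sum of indicators, the count is visibly measurable.\<close>
      have "?R = {\<omega> \<in> space M. real t / 19 \<le> real (\<Sum>n\<in>{1..t}. if X n \<omega> = 1 then 1 else 0)}"
        by (simp add: num_returns_def sum.If_cases Int_def)
      also have "\<dots> \<in> sets M" by measurable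
      finally show "?R \<in> sets M" .
    qed
    finally show ?thesis .
  qed
  show ?thesis
  proof (rule tendsto_sandwich)
    show "(\<lambda>t. 1 - (1 + 9 * real t) / (real t / 2)\<^sup>2) \<longlonglongrightarrow> 1" by real_asymp
    show "\<forall>\<^sub>F t in sequentially. 1 - (1 + 9 * real t) / (real t / 2)\<^sup>2 \<le> ?f t"
      using lower by (auto simp: eventually_sequentially)
  qed auto
qed

end
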